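(* Let $E$ and $T$ be sets, let $\mathcal{H}$ be a Hilbert space of complex-valued functions defined on $T$, and let $\phi\colon E\to\mathcal{H}$ be a map. Write $\phi(t,x)=\phi(x)(t)$ for $(t,x)\in T\times E$. Let $\hat{\mathcal{H}}=\hat\phi(\mathcal{H})$ be the integral transform of $\mathcal{H}$ induced by $\phi$, and write $\hat f=\hat\phi f$ for $f\in\mathcal{H}$. Then the following are equivalent: (i) For every $t\in T$ the function $\overline{\phi(t,\cdot)}\colon x\mapsto\overline{\phi(t,x)}$ on $E$ belongs to $\hat{\mathcal{H}}$, and for all $f\in\overline{\mathrm{span}}\,\phi(E)$ and all $t\in T$, $$f(t)=\langle \hat f,\overline{\phi(t,\cdot)}\rangle_{\hat{\mathcal{H}}}.$$ (ii) The closed subspace $\overline{\mathrm{span}}\,\phi(E)$ of $\mathcal{H}$ is a reproducing kernel Hilbert space on $T$. In particular, if $\mathcal{H}$ is a reproducing kernel Hilbert space on $T$ and $\phi(E)$ is complete in $\mathcal{H}$, then $f(t)=\langle \hat f,\overline{\phi(t,\cdot)}\rangle_{\hat{\mathcal{H}}}$ holds for every $f\in\mathcal{H}$ and every $t\in T$.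
   Context: All Hilbert spaces are complex, with inner product linear in the first variable. A Hilbert space of functions on a set $T$ is a Hilbert space whose elements are functions $T\to\mathbb{C}$ with pointwise linear operations; it is a reproducing kernel Hilbert space (RKHS) on $T$ if for every $t\in T$ the evaluation $f\mapsto f(t)$ is a bounded linear functional (for a closed subspace, with the inherited inner product). Operator range: if $A\colon\mathcal{H}\to V$ is a linear map from a Hilbert space to a vector space with closed kernel, then $\operatorname{ran}A=A(\mathcal{H})$ carries the unique Hilbert space structure with $\langle Af,Ag\rangle_{\operatorname{ran}A}=\langle f,g\rangle_{\mathcal{H}}$ for all $f,g\in(\ker A)^\perp$ (so that $A\colon\mathcal{H}\to\operatorname{ran}A$ is a coisometry). Integral transform: for a map $\phi\colon E\to\mathcal{H}$ from a set to a Hilbert space, define $\hat\phi\colon\mathcal{H}\to\mathbb{C}^E$ by $(\hat\phi f)(x)=\langle f,\phi(x)\rangle_{\mathcal{H}}$, $x\in E$. Its kernel $\phi(E)^\perp$ is closed; $\hat{\mathcal{H}}=\hat\phi(\mathcal{H})$ denotes the operator range of $\hat\phi$ (with its Hilbert space structure), called the integral transform of $\mathcal{H}$ induced by $\phi$. $\overline{\mathrm{span}}\,\phi(E)$ is the closed linear span of $\phi(E)$ in $\mathcal{H}$; $\phi(E)$ is complete in $\mathcal{H}$ if its linear span is dense in $\mathcal{H}$. *)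

theory Defs
  imports "HOL-Analysis.Analysis" "HOL-Library.Function_Algebras"
begin

text \<open>
  The space of complex functions on a set \<open>X\<close> is represented by the functions on the whole
  type that vanish off \<open>X\<close>; this makes restriction to \<open>X\<close> injective, and the pointwise
  operations of \<^theory>\<open>HOL-Library.Function_Algebras\<close> are those of functions on \<open>X\<close>.
\<close>

definition functions_on :: "'a set \<Rightarrow> ('a \<Rightarrow> complex) set" where
  "functions_on X = {f. \<forall>x. x \<notin> X \<longrightarrow> f x = 0}"

definition fun_on :: "'a set \<Rightarrow> ('a \<Rightarrow> complex) \<Rightarrow> 'a \<Rightarrow> complex" where
  "fun_on X f = (\<lambda>x. if x \<in> X then f x else 0)"

definition fun_scale :: "complex \<Rightarrow> ('a \<Rightarrow> complex) \<Rightarrow> 'a \<Rightarrow> complex" where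
  "fun_scale c f = (\<lambda>x. c * f x)"

global_interpretation cfun: vector_space "fun_scale :: complex \<Rightarrow> ('a \<Rightarrow> complex) \<Rightarrow> _"
  by unfold_locales (simp_all add: fun_scale_def fun_eq_iff distrib_left distrib_right mult.assoc)

text \<open>The inner product is only meaningful for arguments in the carrier.\<close>

record 'v inner_space =
  carr :: "'v set"
  inn :: "'v \<Rightarrow> 'v \<Rightarrow> complex"

definition hnorm :: "'v inner_space \<Rightarrow> 'v \<Rightarrow> real" where
  "hnorm H f = sqrt (Re (inn H f f))"

text \<open>
  The locale \<^locale>\<open>Metric_space\<close> requires nonnegativity and symmetry of the distance on the whole
  type, hence the value 0 off the carrier.
\<close>

definition hdist :: "'v::ab_group_add inner_space \<Rightarrow> 'v \<Rightarrow> 'v \<Rightarrow> real" where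
  "hdist H f g = (if f \<in> carr H \<and> g \<in> carr H then hnorm H (f - g) else 0)"

text \<open>The value \<^term>\<open>inn H f f\<close> is real by conjugate symmetry.\<close>

definition hilbert_function_space :: "'a set \<Rightarrow> ('a \<Rightarrow> complex) inner_space \<Rightarrow> bool" where
  "hilbert_function_space X H \<longleftrightarrow>
     carr H \<subseteq> functions_on X \<and>
     cfun.subspace (carr H) \<and>
     (\<forall>f\<in>carr H. \<forall>g\<in>carr H. \<forall>h\<in>carr H. inn H (f + g) h = inn H f h + inn H g h) \<and>
     (\<forall>c. \<forall>f\<in>carr H. \<forall>g\<in>carr H. inn H (fun_scale c f) g = c * inn H f g) \<and>
     (\<forall>f\<in>carr H. \<forall>g\<in>carr H. inn H g f = cnj (inn H f g)) \<and>
     (\<forall>f\<in>carr H. f \<noteq> 0 \<longrightarrow> 0 < Re (inn H f f)) \<and>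
     Metric_space.mcomplete (carr H) (hdist H)"

text \<open>Evaluation is automatically linear, as the operations are pointwise.\<close>

definition rkhs :: "'a set \<Rightarrow> ('a \<Rightarrow> complex) inner_space \<Rightarrow> bool" where
  "rkhs X H \<longleftrightarrow> hilbert_function_space X H \<and>
     (\<forall>x\<in>X. \<exists>C. \<forall>f\<in>carr H. cmod (f x) \<le> C * hnorm H f)"

definition closed_span :: "('a \<Rightarrow> complex) inner_space \<Rightarrow> ('a \<Rightarrow> complex) set \<Rightarrow> ('a \<Rightarrow> complex) set"
  where "closed_span H B = Metric_space.mtopology (carr H) (hdist H) closure_of cfun.span B"

definition complete_in :: "('a \<Rightarrow> complex) set \<Rightarrow> ('a \<Rightarrow> complex) inner_space \<Rightarrow> bool" where
  "complete_in B H \<longleftrightarrow> closed_span H B = carr H"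

definition with_carrier :: "'v inner_space \<Rightarrow> 'v set \<Rightarrow> 'v inner_space" where
  "with_carrier H S = \<lparr>carr = S, inn = inn H\<rparr>"

definition orth_compl :: "'v inner_space \<Rightarrow> 'v set \<Rightarrow> 'v set" where
  "orth_compl H S = {f \<in> carr H. \<forall>g\<in>S. inn H f g = 0}"

definition kernel_on :: "'v inner_space \<Rightarrow> ('v \<Rightarrow> 'w::zero) \<Rightarrow> 'v set" where
  "kernel_on H A = {f \<in> carr H. A f = 0}"

text \<open>
  For a linear map with closed kernel on a Hilbert space, every \<open>u\<close> in the range has exactly one
  preimage in the orthogonal complement of the kernel.
\<close>

definition min_preimage :: "'v inner_space \<Rightarrow> ('v \<Rightarrow> 'w::zero) \<Rightarrow> 'w \<Rightarrow> 'v" where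
  "min_preimage H A u = (THE f. f \<in> orth_compl H (kernel_on H A) \<and> A f = u)"

definition operator_range :: "'v inner_space \<Rightarrow> ('v \<Rightarrow> 'w::zero) \<Rightarrow> 'w inner_space" where
  "operator_range H A =
     \<lparr>carr = A ` carr H, inn = (\<lambda>u v. inn H (min_preimage H A u) (min_preimage H A v))\<rparr>"

definition hat :: "'e set \<Rightarrow> 'v inner_space \<Rightarrow> ('e \<Rightarrow> 'v) \<Rightarrow> 'v \<Rightarrow> 'e \<Rightarrow> complex" where
  "hat E H \<phi> f = fun_on E (\<lambda>x. inn H f (\<phi> x))"

definition integral_transform :: "'e set \<Rightarrow> 'v inner_space \<Rightarrow> ('e \<Rightarrow> 'v) \<Rightarrow> ('e \<Rightarrow> complex) inner_space"
  where "integral_transform E H \<phi> = operator_range H (hat E H \<phi>)"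

text \<open>The defining property of the operator range.\<close>

lemma operator_range_inner:
  fixes A :: "('a \<Rightarrow> complex) \<Rightarrow> 'w::ab_group_add"
  assumes H: "hilbert_function_space X H"
    and A: "\<And>f g. f \<in> carr H \<Longrightarrow> g \<in> carr H \<Longrightarrow> A (f - g) = A f - A g"
    and f: "f \<in> orth_compl H (kernel_on H A)" and g: "g \<in> orth_compl H (kernel_on H A)"
  shows "inn (operator_range H A) (A f) (A g) = inn H f g"
proof -
  have sub: "cfun.subspace (carr H)"
    and add: "\<forall>f\<in>carr H. \<forall>g\<in>carr H. \<forall>h\<in>carr H. inn H (f + g) h = inn H f h + inn H g h"
    and pos: "\<forall>f\<in>carr H. f \<noteq> 0 \<longrightarrow> 0 < Re (inn H f f)"
    using H unfolding hilbert_function_space_def by - (elim conjE, assumption)+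
  have pre: "min_preimage H A (A h) = h" if h: "h \<in> orth_compl H (kernel_on H A)" for h
    unfolding min_preimage_def
  proof (rule the_equality)
    fix k assume k: "k \<in> orth_compl H (kernel_on H A) \<and> A k = A h"
    define d where "d = k - h"
    have kh: "k \<in> carr H" "h \<in> carr H" using h k by (auto simp: orth_compl_def)
    have dH: "d \<in> carr H" unfolding d_def
      using sub kh by (rule cfun.subspace_diff)
    have dk: "d \<in> kernel_on H A" using dH kh k A by (auto simp: kernel_on_def d_def)
    have "inn H (d + h) d = inn H d d + inn H h d"
      using add dH kh(2) by blast
    moreover have "inn H h d = 0" "inn H k d = 0" using h k dk by (auto simp: orth_compl_def)
    ultimately have "inn H d d = 0" by (simp add: d_def)
    then have "d = 0" using pos dH by force
    then show "k = h" by (simp add: d_def)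
  qed (use h in auto)
  show ?thesis by (simp add: operator_range_def pre f g)
qed

end

theory Submission
  imports Defs
begin

text \<open>
  Write \<open>M\<close> for the closed span of \<open>\<phi>(E)\<close>. A function \<open>g\<close> is sent to 0 by the integral transform
  exactly when it is orthogonal to \<open>\<phi>(E)\<close>, hence exactly when it is orthogonal to \<open>M\<close>. So the
  transform loses nothing when it is restricted to \<open>M\<close>, and it carries \<open>M\<close> isometrically onto the
  transformed space: every transformed function comes from \<open>M\<close> (lemma
  \<open>integral_transform_carr\<close>), and inner products of elements of \<open>M\<close> are preserved (lemma
  \<open>integral_transform_inner\<close>).

  Under this isometry, the inversion formula at a point \<open>t\<close> says that evaluation at \<open>t\<close> is the
  inner product with an element \<open>k\<close> of \<open>M\<close> whose transform is \<open>x \<mapsto> cnj (\<phi> x t)\<close>. If such a \<open>k\<close> exists,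
  evaluation is bounded on \<open>M\<close> by the Cauchy-Schwarz inequality. Conversely, if evaluation is
  bounded on \<open>M\<close>, the Riesz representation theorem supplies \<open>k\<close>, and its transform is the
  required function because \<open>\<langle>k, \<phi> x\<rangle>\<close> is the conjugate of \<open>\<langle>\<phi> x, k\<rangle> = \<phi> x t\<close>.

  Both halves rest on the Riesz theorem in the Hilbert space \<open>M\<close>. For the first it
  provides the orthogonal projection of \<open>h\<close> onto \<open>M\<close>, as the element of \<open>M\<close> that represents the
  functional \<open>f \<mapsto> \<langle>f, h\<rangle>\<close>; this is how a preimage \<open>k\<close> can be moved into \<open>M\<close>.
\<close>

section \<open>Inner product spaces of functions\<close>

text \<open>
  Completeness is left out so that the closed span can be shown to be an inner product space before
  it is known to be complete.
\<close>

locale inner_function_space =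
  fixes H :: "('a \<Rightarrow> complex) inner_space"
  assumes subspace_carr: "cfun.subspace (carr H)"
    and inn_add_left: "\<lbrakk>f \<in> carr H; g \<in> carr H; h \<in> carr H\<rbrakk> \<Longrightarrow> inn H (f + g) h = inn H f h + inn H g h"
    and inn_scale_left: "\<And>c f g. \<lbrakk>f \<in> carr H; g \<in> carr H\<rbrakk> \<Longrightarrow> inn H (fun_scale c f) g = c * inn H f g"
    and inn_sym: "\<lbrakk>f \<in> carr H; g \<in> carr H\<rbrakk> \<Longrightarrow> inn H g f = cnj (inn H f g)"
    and inn_pos: "\<lbrakk>f \<in> carr H; f \<noteq> 0\<rbrakk> \<Longrightarrow> 0 < Re (inn H f f)"
begin

lemma zero_mem [simp]: "0 \<in> carr H"
  and add_mem [simp]: "\<lbrakk>f \<in> carr H; g \<in> carr H\<rbrakk> \<Longrightarrow> f + g \<in> carr H"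
  and diff_mem [simp]: "\<lbrakk>f \<in> carr H; g \<in> carr H\<rbrakk> \<Longrightarrow> f - g \<in> carr H"
  and scale_mem [simp]: "f \<in> carr H \<Longrightarrow> fun_scale c f \<in> carr H"
  using subspace_carr cfun.subspace_0 cfun.subspace_add cfun.subspace_diff cfun.subspace_scale by blast+

lemma inn_diff_left:
  assumes "f \<in> carr H" "g \<in> carr H" "h \<in> carr H"
  shows "inn H (f - g) h = inn H f h - inn H g h"
  using inn_add_left[of "f - g" g h] assms by simp

lemma inn_add_right:
  assumes "f \<in> carr H" "g \<in> carr H" "h \<in> carr H"
  shows "inn H h (f + g) = inn H h f + inn H h g"
  using assms by (simp add: inn_sym[of _ h] inn_add_left)

lemma inn_diff_right:
  assumes "f \<in> carr H" "g \<in> carr H" "h \<in> carr H"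
  shows "inn H h (f - g) = inn H h f - inn H h g"
  using assms by (simp add: inn_sym[of _ h] inn_diff_left)

lemma inn_scale_right:
  assumes "f \<in> carr H" "g \<in> carr H"
  shows "inn H g (fun_scale c f) = cnj c * inn H g f"
  using assms by (simp add: inn_sym[of _ g] inn_scale_left)

lemma inn_zero_left [simp]: "f \<in> carr H \<Longrightarrow> inn H 0 f = 0"
  using inn_diff_left[of f f f] by simp

lemmas inn_expand = inn_add_left inn_add_right inn_diff_left inn_diff_right
  inn_scale_left inn_scale_right

lemma hnorm_zero [simp]: "hnorm H 0 = 0"
  by (simp add: hnorm_def)

lemma Re_inn_nonneg: "f \<in> carr H \<Longrightarrow> 0 \<le> Re (inn H f f)"
  using inn_pos[of f] by (cases "f = 0") auto

lemma hnorm_nonneg [simp]: "f \<in> carr H \<Longrightarrow> 0 \<le> hnorm H f"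
  by (simp add: hnorm_def Re_inn_nonneg)

lemma hnorm_eq_0: "f \<in> carr H \<Longrightarrow> hnorm H f = 0 \<longleftrightarrow> f = 0"
  using inn_pos[of f] by (cases "f = 0") (auto simp: hnorm_def)

lemma inn_self: "f \<in> carr H \<Longrightarrow> inn H f f = complex_of_real ((hnorm H f)\<^sup>2)"
  using inn_sym[of f f] Re_inn_nonneg[of f] by (simp add: hnorm_def complex_eq_iff)

lemma hnorm_power2: "f \<in> carr H \<Longrightarrow> (hnorm H f)\<^sup>2 = Re (inn H f f)"
  by (simp add: inn_self)

lemma hnorm_add_power2:
  assumes "f \<in> carr H" "g \<in> carr H"
  shows "(hnorm H (f + g))\<^sup>2 = (hnorm H f)\<^sup>2 + 2 * Re (inn H f g) + (hnorm H g)\<^sup>2"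
  using assms inn_sym[of f g] by (simp add: hnorm_power2 inn_expand)

lemma hnorm_diff_power2:
  assumes "f \<in> carr H" "g \<in> carr H"
  shows "(hnorm H (f - g))\<^sup>2 = (hnorm H f)\<^sup>2 - 2 * Re (inn H f g) + (hnorm H g)\<^sup>2"
  using assms inn_sym[of f g] by (simp add: hnorm_power2 inn_expand)

lemma hnorm_scale:
  assumes "f \<in> carr H"
  shows "hnorm H (fun_scale c f) = cmod c * hnorm H f"
proof -
  have "inn H (fun_scale c f) (fun_scale c f) = complex_of_real ((cmod c)\<^sup>2) * inn H f f"
    using assms by (simp add: inn_expand complex_norm_square mult_ac del: of_real_power)
  then have "(hnorm H (fun_scale c f))\<^sup>2 = (cmod c * hnorm H f)\<^sup>2"
    using assms by (simp add: hnorm_power2 power_mult_distrib)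
  then show ?thesis
    using assms by (simp add: power2_eq_iff_nonneg)
qed

lemma hnorm_minus_commute:
  assumes "f \<in> carr H" "g \<in> carr H"
  shows "hnorm H (f - g) = hnorm H (g - f)"
proof -
  have "fun_scale (- 1) (f - g) = g - f"
    by (simp add: fun_eq_iff fun_scale_def)
  moreover have "hnorm H (fun_scale (- 1) (f - g)) = hnorm H (f - g)"
    by (subst hnorm_scale) (use assms in auto)
  ultimately show ?thesis by (simp only:)
qed

text \<open>
  Subtracting from \<open>f\<close> its component along \<open>g\<close> leaves a vector whose squared norm, being
  nonnegative, is the gap in the squared inequality divided by \<open>\<parallel>g\<parallel>\<^sup>2\<close>.
\<close>

lemma Cauchy_Schwarz:
  assumes f: "f \<in> carr H" and g: "g \<in> carr H"
  shows "cmod (inn H f g) \<le> hnorm H f * hnorm H g"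
proof (cases "g = 0")
  case True
  with f show ?thesis using inn_sym[of 0 f] by simp
next
  case False
  define G where "G = (hnorm H g)\<^sup>2"
  have G: "G > 0" using False g hnorm_eq_0[of g] by (simp add: G_def)
  define c where "c = inn H f g / complex_of_real G"
  have "0 \<le> (hnorm H (f - fun_scale c g))\<^sup>2" by simp
  also have "\<dots> = (hnorm H f)\<^sup>2 - 2 * Re (cnj c * inn H f g) + (cmod c)\<^sup>2 * G"
    using f g by (simp add: hnorm_diff_power2 inn_scale_right hnorm_scale power_mult_distrib G_def)
  also have "cnj c * inn H f g = complex_of_real ((cmod (inn H f g))\<^sup>2 / G)"
  proof -
    have "cnj c * inn H f g = inn H f g * cnj (inn H f g) / complex_of_real G"
      by (simp add: c_def)
    also have "\<dots> = complex_of_real ((cmod (inn H f g))\<^sup>2 / G)"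
      by (simp only: complex_norm_square[symmetric] of_real_divide)
    finally show ?thesis .
  qed
  also have "(cmod c)\<^sup>2 * G = (cmod (inn H f g))\<^sup>2 / G"
    using G by (simp add: c_def norm_divide power2_eq_square)
  finally have "(cmod (inn H f g))\<^sup>2 / G \<le> (hnorm H f)\<^sup>2" by simp
  then have "(cmod (inn H f g))\<^sup>2 \<le> (hnorm H f * hnorm H g)\<^sup>2"
    using G by (simp add: divide_le_eq power_mult_distrib G_def)
  then show ?thesis
    using f g by (simp add: power2_le_iff_abs_le)
qed

lemma hnorm_triangle:
  assumes f: "f \<in> carr H" and g: "g \<in> carr H"
  shows "hnorm H (f + g) \<le> hnorm H f + hnorm H g"
proof -
  have "(hnorm H (f + g))\<^sup>2 \<le> (hnorm H f + hnorm H g)\<^sup>2"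
    using Cauchy_Schwarz[OF f g] complex_Re_le_cmod[of "inn H f g"]
    by (simp add: hnorm_add_power2 f g power2_sum)
  then show ?thesis
    using f g by (simp add: power2_le_iff_abs_le)
qed

sublocale Metric_space "carr H" "hdist H"
proof
  fix f g h
  show "0 \<le> hdist H f g" by (simp add: hdist_def)
  show "hdist H f g = hdist H g f" by (simp add: hdist_def hnorm_minus_commute)
  assume f: "f \<in> carr H" and g: "g \<in> carr H"
  then show "hdist H f g = 0 \<longleftrightarrow> f = g" by (simp add: hdist_def hnorm_eq_0)
  assume h: "h \<in> carr H"
  show "hdist H f h \<le> hdist H f g + hdist H g h"
    using hnorm_triangle[of "f - g" "g - h"] f g h by (simp add: hdist_def)
qed

text \<open>
  The distance is 0 off the carrier, so a subspace does not inherit it by restriction as a function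
  on the whole type. The norm is inherited; in terms of it, completeness of a subspace can be
  derived from completeness of the ambient space.
\<close>

lemma mcomplete_iff_Cauchy:
  "mcomplete \<longleftrightarrow> (\<forall>s. range s \<subseteq> carr H \<and>
      (\<forall>e>0. \<exists>N. \<forall>m\<ge>N. \<forall>n\<ge>N. hnorm H (s m - s n) < e) \<longrightarrow>
      (\<exists>f\<in>carr H. (\<lambda>n. hnorm H (s n - f)) \<longlonglongrightarrow> 0))"
proof -
  have dist: "hdist H (s m) (s n) = hnorm H (s m - s n)" if "range s \<subseteq> carr H" for s m n
    using that by (simp add: hdist_def image_subset_iff)
  have Cauchy: "MCauchy s \<longleftrightarrow> range s \<subseteq> carr H \<and>
      (\<forall>e>0. \<exists>N. \<forall>m\<ge>N. \<forall>n\<ge>N. hnorm H (s m - s n) < e)" for s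
    unfolding MCauchy_def by (rule conj_cong[OF refl]) (simp add: dist)
  have lim: "limitin mtopology s f sequentially \<longleftrightarrow>
      f \<in> carr H \<and> (\<lambda>n. hnorm H (s n - f)) \<longlonglongrightarrow> 0" if "range s \<subseteq> carr H" for s f
  proof (cases "f \<in> carr H")
    case True
    then have "hdist H (s n) f = hnorm H (s n - f)" for n
      using that by (simp add: hdist_def image_subset_iff)
    with True that show ?thesis
      by (simp add: limitin_metric_dist_null image_subset_iff)
  qed (simp add: limitin_metric_dist_null)
  show ?thesis
    unfolding mcomplete_def Cauchy
    by (intro all_cong1 imp_cong refl) (simp add: lim Bex_def)
qed

lemma mem_closed_span_iff:
  assumes "B \<subseteq> carr H"
  shows "f \<in> closed_span H B \<longleftrightarrow>
    f \<in> carr H \<and> (\<forall>e>0. \<exists>g\<in>cfun.span B. hnorm H (f - g) < e)"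
proof -
  have span: "g \<in> carr H" if "g \<in> cfun.span B" for g
    using cfun.span_minimal[OF assms subspace_carr] that by blast
  have "g \<in> mball f e \<longleftrightarrow> hnorm H (f - g) < e" if "f \<in> carr H" "g \<in> cfun.span B" for g e
    using that(1) span[OF that(2)] by (simp only: in_mball hdist_def simp_thms if_True)
  then show ?thesis
    unfolding closed_span_def metric_closure_of mem_Collect_eq by blast
qed

lemma subset_closed_span:
  assumes "B \<subseteq> carr H"
  shows "B \<subseteq> closed_span H B"
proof
  fix b assume "b \<in> B"
  then show "b \<in> closed_span H B"
    unfolding mem_closed_span_iff[OF assms]
    using assms cfun.span_base[of b B] by (metis diff_self hnorm_zero subsetD)
qed

text \<open>
  The annihilator of a vector is a closed subspace: linearity passes from \<open>B\<close> to its span, and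
  the Cauchy-Schwarz inequality passes from the span to its closure.
\<close>

lemma orth_closed_span:
  assumes B: "B \<subseteq> carr H" and g: "g \<in> carr H" and orth: "\<And>b. b \<in> B \<Longrightarrow> inn H g b = 0"
    and f: "f \<in> closed_span H B"
  shows "inn H f g = 0"
proof -
  have span: "h \<in> carr H \<and> inn H h g = 0" if "h \<in> cfun.span B" for h
    using that
  proof (induction rule: cfun.span_induct_alt)
    case (step c b h)
    then have "b \<in> carr H" "inn H b g = 0" using B orth[of b] inn_sym[of g b] g by auto
    then have "fun_scale c b + h \<in> carr H \<and> inn H (fun_scale c b + h) g = 0"
      using step g by (simp add: inn_expand)
    then show ?case by (simp add: plus_fun_def)
  next
    case base
    have "0 \<in> carr H \<and> inn H 0 g = 0" using g by simp
    then show ?case by (simp add: zero_fun_def)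
  qed
  have fH: "f \<in> carr H" using f B by (simp add: mem_closed_span_iff)
  have "cmod (inn H f g) \<le> 0 + e" if "e > 0" for e
  proof -
    have G: "0 < hnorm H g + 1" using g by (simp add: add_nonneg_pos)
    then have "0 < e / (hnorm H g + 1)" using that by simp
    then obtain h where h: "h \<in> cfun.span B" "hnorm H (f - h) < e / (hnorm H g + 1)"
      using f unfolding mem_closed_span_iff[OF B] by blast
    have "cmod (inn H f g) = cmod (inn H (f - h) g)"
      using span[OF h(1)] fH g by (simp add: inn_diff_left)
    also have "\<dots> \<le> hnorm H (f - h) * hnorm H g"
      using span[OF h(1)] fH g by (intro Cauchy_Schwarz) auto
    also have "\<dots> \<le> hnorm H (f - h) * (hnorm H g + 1)"
      using span[OF h(1)] fH g by (intro mult_left_mono) auto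
    also have "\<dots> \<le> e" using h(2) G by (simp add: less_divide_eq)
    finally show ?thesis by simp
  qed
  then have "cmod (inn H f g) \<le> 0" by (rule field_le_epsilon)
  then show ?thesis by simp
qed

end

section \<open>Riesz representation\<close>

lemma hilbert_function_space_iff:
  "hilbert_function_space X H \<longleftrightarrow>
     carr H \<subseteq> functions_on X \<and> inner_function_space H \<and>
     Metric_space.mcomplete (carr H) (hdist H)"
  unfolding hilbert_function_space_def inner_function_space_def
  by (simp only: Ball_def all_simps conj_assoc)

locale hilbert_functions = inner_function_space +
  assumes mcomplete: mcomplete
begin

lemma Cauchy_limit:
  assumes "\<And>n. s n \<in> carr H"
    and "\<And>e. e > 0 \<Longrightarrow> \<exists>N. \<forall>m\<ge>N. \<forall>n\<ge>N. hnorm H (s m - s n) < e"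
  obtains f where "f \<in> carr H" "(\<lambda>n. hnorm H (s n - f)) \<longlonglongrightarrow> 0"
proof -
  have "range s \<subseteq> carr H" using assms(1) by blast
  moreover have "\<forall>e>0. \<exists>N. \<forall>m\<ge>N. \<forall>n\<ge>N. hnorm H (s m - s n) < e" using assms(2) by simp
  ultimately have "\<exists>f\<in>carr H. (\<lambda>n. hnorm H (s n - f)) \<longlonglongrightarrow> 0"
    by (rule mcomplete[unfolded mcomplete_iff_Cauchy, THEN spec, THEN mp, OF conjI])
  then show ?thesis using that by blast
qed

text \<open>
  The representing vector is the minimiser of \<open>J f = \<parallel>f\<parallel>\<^sup>2 - 2 Re (L f)\<close>: if \<open>L f = \<langle>f, k\<rangle>\<close>, then
  \<open>J f = \<parallel>f - k\<parallel>\<^sup>2 - \<parallel>k\<parallel>\<^sup>2\<close>. Boundedness of \<open>L\<close> makes \<open>J\<close> bounded below, the parallelogram law makes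
  minimising sequences Cauchy, and the vanishing of the derivative of \<open>J\<close> at the limit is the real
  part of the representation; multiplication by \<open>\<i>\<close> gives the imaginary part.
\<close>

theorem Riesz_representation:
  assumes add: "\<And>f g. \<lbrakk>f \<in> carr H; g \<in> carr H\<rbrakk> \<Longrightarrow> L (f + g) = L f + L g"
    and scale: "\<And>c f. f \<in> carr H \<Longrightarrow> L (fun_scale c f) = c * L f"
    and bounded: "\<And>f. f \<in> carr H \<Longrightarrow> cmod (L f) \<le> C * hnorm H f"
  obtains k where "k \<in> carr H" "\<And>f. f \<in> carr H \<Longrightarrow> L f = inn H f k"
proof -
  define J where "J f = (hnorm H f)\<^sup>2 - 2 * Re (L f)" for f
  have diff: "L (f - g) = L f - L g" if "f \<in> carr H" "g \<in> carr H" for f g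
    using add[of "f - g" g] that by simp
  have Re_L: "\<bar>Re (L f)\<bar> \<le> C * hnorm H f" if "f \<in> carr H" for f
    using bounded[OF that] abs_Re_le_cmod[of "L f"] by linarith
  have below: "- C\<^sup>2 \<le> J f" if "f \<in> carr H" for f
  proof -
    have "0 \<le> (hnorm H f - C)\<^sup>2" by simp
    then show ?thesis
      using Re_L[OF that] by (simp add: J_def power2_diff algebra_simps)
  qed
  define d where "d = (INF f\<in>carr H. J f)"
  have bdd: "bdd_below (J ` carr H)" using below by (auto intro!: bdd_belowI2)
  have d_le: "d \<le> J f" if "f \<in> carr H" for f
    unfolding d_def using bdd that by (rule cINF_lower)
  have "\<exists>f\<in>carr H. J f < d + inverse (real (Suc n))" for n
  proof -
    have "(INF f\<in>carr H. J f) < d + inverse (real (Suc n))"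
      by (simp add: d_def)
    moreover have "carr H \<noteq> {}" using zero_mem by blast
    ultimately show ?thesis using bdd by (simp add: cINF_less_iff)
  qed
  then obtain s where s: "\<And>n. s n \<in> carr H" and Js: "\<And>n. J (s n) < d + inverse (real (Suc n))"
    by metis
  \<comment> \<open>Parallelogram law, applied with the midpoint of \<open>f\<close> and \<open>g\<close>, where \<open>J\<close> is at least \<open>d\<close>.\<close>
  have gap: "(hnorm H (f - g))\<^sup>2 \<le> 2 * (J f - d) + 2 * (J g - d)"
    if f: "f \<in> carr H" and g: "g \<in> carr H" for f g
  proof -
    define m where "m = fun_scale (1/2) (f + g)"
    have m: "m \<in> carr H" using f g by (simp add: m_def)
    have "4 * (hnorm H m)\<^sup>2 = (hnorm H (f + g))\<^sup>2"
      using f g by (simp add: m_def hnorm_scale power_divide)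
    moreover have "2 * Re (L m) = Re (L f) + Re (L g)"
      using f g by (simp add: m_def scale add)
    ultimately have "(hnorm H (f - g))\<^sup>2 = 2 * J f + 2 * J g - 4 * J m"
      using f g by (simp add: J_def hnorm_add_power2 hnorm_diff_power2)
    then show ?thesis using d_le[OF m] by simp
  qed
  have Cauchy: "\<exists>N. \<forall>m\<ge>N. \<forall>n\<ge>N. hnorm H (s m - s n) < e" if "e > 0" for e
  proof -
    define c where "c = e\<^sup>2 / 4"
    then have e2: "e\<^sup>2 = 4 * c" by simp
    have "c > 0" using \<open>e > 0\<close> by (simp add: c_def)
    then obtain N where N: "inverse (real (Suc N)) < c"
      using reals_Archimedean[of c] by auto
    have J_small: "J (s n) - d < c" if "n \<ge> N" for n
    proof -
      have "inverse (real (Suc n)) \<le> inverse (real (Suc N))"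
        using that by (simp add: le_imp_inverse_le)
      then show ?thesis using N Js[of n] by linarith
    qed
    have "hnorm H (s m - s n) < e" if "m \<ge> N" "n \<ge> N" for m n
    proof -
      have "(hnorm H (s m - s n))\<^sup>2 < e\<^sup>2"
        using gap[OF s[of m] s[of n]] J_small[OF that(1)] J_small[OF that(2)] e2 by argo
      then show ?thesis by (rule power2_less_imp_less) (use \<open>e > 0\<close> in simp)
    qed
    then show ?thesis by blast
  qed
  obtain k where k: "k \<in> carr H" and lim: "(\<lambda>n. hnorm H (s n - k)) \<longlonglongrightarrow> 0"
    by (rule Cauchy_limit[OF s Cauchy])
  \<comment> \<open>Lower semicontinuity of \<open>J\<close> suffices: the squared norm lies above its tangent at \<open>k\<close>.\<close>
  have J_k: "J k \<le> d"
  proof -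
    have "J k \<le> d + inverse (real (Suc n)) + 2 * (hnorm H k + C) * hnorm H (s n - k)" for n
    proof -
      have "(hnorm H k)\<^sup>2 \<le> (hnorm H (s n))\<^sup>2 + 2 * hnorm H k * hnorm H (s n - k)"
      proof -
        have "(hnorm H (s n))\<^sup>2 = (hnorm H k)\<^sup>2 + 2 * Re (inn H k (s n - k)) + (hnorm H (s n - k))\<^sup>2"
          using hnorm_add_power2[OF k, of "s n - k"] s k by simp
        moreover have "\<bar>Re (inn H k (s n - k))\<bar> \<le> hnorm H k * hnorm H (s n - k)"
          by (rule order_trans[OF abs_Re_le_cmod Cauchy_Schwarz]) (use s k in simp_all)
        moreover have "0 \<le> (hnorm H (s n - k))\<^sup>2" by simp
        ultimately show ?thesis unfolding mult.assoc by arith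
      qed
      moreover have "\<bar>Re (L (s n)) - Re (L k)\<bar> \<le> C * hnorm H (s n - k)"
        using Re_L[of "s n - k"] diff[OF s k] s k by simp
      ultimately show ?thesis
        using Js[of n] by (simp add: J_def algebra_simps)
    qed
    moreover have "(\<lambda>n. d + inverse (real (Suc n)) + 2 * (hnorm H k + C) * hnorm H (s n - k))
        \<longlonglongrightarrow> d + 0 + 2 * (hnorm H k + C) * 0"
      by (intro tendsto_intros lim LIMSEQ_inverse_real_of_nat)
    ultimately show ?thesis
      using LIMSEQ_le_const[of _ d "J k"] by auto
  qed
  have Re_eq: "Re (L f) = Re (inn H f k)" if f: "f \<in> carr H" for f
  proof -
    define a where "a = Re (inn H f k) - Re (L f)"
    \<comment> \<open>Minimality of \<open>k\<close> along the line through \<open>k\<close> in direction \<open>f\<close>; \<open>2 * a\<close> is the derivative of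
      \<open>J\<close> in that direction.\<close>
    have quadratic: "0 \<le> 2 * r * a + r\<^sup>2 * (hnorm H f)\<^sup>2" for r :: real
    proof -
      have "J k \<le> J (k + fun_scale r f)"
        using J_k d_le[of "k + fun_scale r f"] k f by simp
      moreover have "Re (inn H k f) = Re (inn H f k)"
        using inn_sym[OF f k] by simp
      ultimately show ?thesis
        using k f by (simp add: J_def a_def hnorm_add_power2 inn_scale_right hnorm_scale add scale
            power_mult_distrib algebra_simps)
    qed
    have "a = 0"
    proof -
      define B where "B = (hnorm H f)\<^sup>2 + 1"
      have B: "B > 0" by (simp add: B_def add_nonneg_pos)
      \<comment> \<open>The choice \<open>r = - a / B\<close> makes the linear term dominate; adding 1 to \<open>\<parallel>f\<parallel>\<^sup>2\<close> avoids
        division by 0 when \<open>f = 0\<close>.\<close>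
      have "0 \<le> 2 * (- a / B) * a + (- a / B)\<^sup>2 * (hnorm H f)\<^sup>2" by (rule quadratic)
      also have "\<dots> \<le> 2 * (- a / B) * a + (- a / B)\<^sup>2 * B"
        by (intro add_left_mono mult_left_mono) (simp_all add: B_def)
      also have "\<dots> = - (a\<^sup>2 / B)"
        using B by (simp add: power2_eq_square)
      finally have "a\<^sup>2 \<le> 0"
        using B by (simp add: divide_le_0_iff)
      then show ?thesis by simp
    qed
    then show ?thesis by (simp add: a_def)
  qed
  have "L f = inn H f k" if f: "f \<in> carr H" for f
    using Re_eq[OF f] Re_eq[of "fun_scale \<i> f"] f k
    by (simp add: complex_eq_iff scale inn_scale_left)
  with k show ?thesis using that by blast
qed

section \<open>The closed span as a Hilbert space\<close>

lemma closed_span_hilbert: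
  assumes B: "B \<subseteq> carr H"
  shows "hilbert_functions (with_carrier H (closed_span H B))"
proof -
  let ?M = "closed_span H B"
  note mem = mem_closed_span_iff[OF B]
  have span: "g \<in> carr H" if "g \<in> cfun.span B" for g
    using cfun.span_minimal[OF B subspace_carr] that by blast
  have M: "f \<in> carr H" if "f \<in> ?M" for f using that mem by blast
  have sub: "cfun.subspace ?M"
  proof (rule cfun.subspaceI)
    show "0 \<in> ?M"
      unfolding mem using cfun.span_zero by (metis diff_self hnorm_zero zero_mem)
  next
    fix f g assume fg: "f \<in> ?M" "g \<in> ?M"
    have "\<exists>h\<in>cfun.span B. hnorm H (f + g - h) < e" if "e > 0" for e
    proof -
      have "0 < e / 2" using that by simp
      then obtain f' g' where f': "f' \<in> cfun.span B" "hnorm H (f - f') < e / 2"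
        and g': "g' \<in> cfun.span B" "hnorm H (g - g') < e / 2"
        using fg unfolding mem by blast
      have "hnorm H ((f - f') + (g - g')) < e"
        using hnorm_triangle[of "f - f'" "g - g'"] f' g' span M fg by simp
      moreover have "(f - f') + (g - g') = f + g - (f' + g')" by (rule add_diff_add[symmetric])
      ultimately have "hnorm H (f + g - (f' + g')) < e" by (simp only:)
      then show ?thesis using f' g' cfun.span_add by blast
    qed
    then show "f + g \<in> ?M" using fg unfolding mem by simp
  next
    fix c f assume f: "f \<in> ?M"
    have "\<exists>h\<in>cfun.span B. hnorm H (fun_scale c f - h) < e" if "e > 0" for e
    proof -
      have c: "0 < cmod c + 1" by (simp add: add_nonneg_pos)
      then have "0 < e / (cmod c + 1)" using that by simp
      then obtain g where g: "g \<in> cfun.span B" "hnorm H (f - g) < e / (cmod c + 1)"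
        using f unfolding mem by blast
      have "fun_scale c f - fun_scale c g = fun_scale c (f - g)"
        by (simp add: fun_scale_def fun_eq_iff algebra_simps)
      then have "hnorm H (fun_scale c f - fun_scale c g) = cmod c * hnorm H (f - g)"
        using M f g span by (simp add: hnorm_scale)
      also have "\<dots> \<le> (cmod c + 1) * hnorm H (f - g)"
        using M f g span by (intro mult_right_mono) auto
      also have "\<dots> < e"
        using g(2) c by (simp add: less_divide_eq mult.commute)
      finally show ?thesis using g cfun.span_scale by blast
    qed
    then show "fun_scale c f \<in> ?M" using f unfolding mem by simp
  qed
  let ?H = "with_carrier H ?M"
  have norm [simp]: "hnorm ?H f = hnorm H f" for f by (simp add: hnorm_def with_carrier_def)
  interpret M: inner_function_space ?H
    by unfold_locales
      (use M sub in \<open>auto simp: with_carrier_def inn_add_left inn_scale_left inn_pos intro: inn_sym\<close>)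
  have "M.mcomplete"
    unfolding M.mcomplete_iff_Cauchy
  proof (intro allI impI, elim conjE)
    fix s :: "nat \<Rightarrow> _"
    assume s: "range s \<subseteq> carr ?H"
      and Cauchy: "\<forall>e>0. \<exists>N. \<forall>m\<ge>N. \<forall>n\<ge>N. hnorm ?H (s m - s n) < e"
    have sM: "s n \<in> ?M" for n using s by (auto simp: with_carrier_def)
    obtain f where f: "f \<in> carr H" and lim: "(\<lambda>n. hnorm H (s n - f)) \<longlonglongrightarrow> 0"
      by (rule Cauchy_limit[OF M[OF sM] Cauchy[unfolded norm, rule_format]])
    have "\<exists>g\<in>cfun.span B. hnorm H (f - g) < e" if "e > 0" for e
    proof -
      have "\<forall>\<^sub>F n in sequentially. hnorm H (s n - f) < e / 2"
        using order_tendstoD(2)[OF lim, of "e / 2"] \<open>e > 0\<close> by simp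
      then obtain n where n: "hnorm H (s n - f) < e / 2"
        using eventually_happens'[OF sequentially_bot] by blast
      have "0 < e / 2" using that by simp
      then obtain g where g: "g \<in> cfun.span B" "hnorm H (s n - g) < e / 2"
        using sM[of n] unfolding mem by blast
      have "hnorm H (f - g) < e"
        using hnorm_triangle[of "f - s n" "s n - g"] hnorm_minus_commute[OF f M[OF sM[of n]]]
          n g span[OF g(1)] f M[OF sM[of n]] by simp
      then show ?thesis using g by blast
    qed
    then have "f \<in> ?M" using f unfolding mem by blast
    then show "\<exists>f\<in>carr ?H. (\<lambda>n. hnorm ?H (s n - f)) \<longlonglongrightarrow> 0"
      unfolding norm using lim by (auto simp: with_carrier_def)
  qed
  then show ?thesis
    by unfold_locales
qed

text \<open>
  The orthogonal projection \<open>k\<close> of \<open>h\<close> arises as the Riesz representative, inside the closed span,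
  of the functional \<open>f \<mapsto> \<langle>f, h\<rangle>\<close>; minimising a distance a second time is thereby avoided.
\<close>

lemma projection_closed_span:
  assumes B: "B \<subseteq> carr H" and h: "h \<in> carr H"
  obtains k where "k \<in> closed_span H B" "\<And>f. f \<in> closed_span H B \<Longrightarrow> inn H f h = inn H f k"
proof -
  let ?M = "closed_span H B"
  interpret M: hilbert_functions "with_carrier H ?M" by (rule closed_span_hilbert[OF B])
  have M: "f \<in> carr H" if "f \<in> ?M" for f using that B by (simp add: mem_closed_span_iff)
  obtain k where "k \<in> ?M" "\<And>f. f \<in> ?M \<Longrightarrow> inn H f h = inn H f k"
  proof (rule M.Riesz_representation[of "\<lambda>f. inn H f h" "hnorm H h"])
    show "cmod (inn H f h) \<le> hnorm H h * hnorm (with_carrier H ?M) f"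
      if "f \<in> carr (with_carrier H ?M)" for f
      using that Cauchy_Schwarz[OF M h] by (simp add: with_carrier_def hnorm_def mult.commute)
  qed (use h M in \<open>auto simp: with_carrier_def inn_expand\<close>)
  then show ?thesis by (rule that)
qed

end

section \<open>The integral transform on the closed span\<close>

context
  fixes E :: "'e set" and H :: "('t \<Rightarrow> complex) inner_space"
    and \<phi> :: "'e \<Rightarrow> 't \<Rightarrow> complex" and T :: "'t set"
  assumes H: "hilbert_function_space T H" and \<phi>: "\<phi> \<in> E \<rightarrow> carr H"
begin

interpretation hilbert_functions H
  using H unfolding hilbert_function_space_iff hilbert_functions_def hilbert_functions_axioms_def
  by blast

lemma \<phi>_sub: "\<phi> ` E \<subseteq> carr H"
  using \<phi> by blast

lemma closed_span_carr: "f \<in> closed_span H (\<phi> ` E) \<Longrightarrow> f \<in> carr H"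
  by (simp add: mem_closed_span_iff[OF \<phi>_sub])

text \<open>
  The operator range inherits the inner product of the orthogonal complement of the kernel; the
  kernel is orthogonal to \<open>\<phi>(E)\<close>, so this complement contains the closed span.
\<close>

lemma integral_transform_inner:
  assumes "f \<in> closed_span H (\<phi> ` E)" "g \<in> closed_span H (\<phi> ` E)"
  shows "inn (integral_transform E H \<phi>) (hat E H \<phi> f) (hat E H \<phi> g) = inn H f g"
  unfolding integral_transform_def
proof (rule operator_range_inner[OF H])
  show "hat E H \<phi> (f - g) = hat E H \<phi> f - hat E H \<phi> g" if "f \<in> carr H" "g \<in> carr H" for f g
    using that \<phi> by (auto simp: hat_def fun_on_def fun_eq_iff inn_diff_left Pi_iff)
  have "h \<in> orth_compl H (kernel_on H (hat E H \<phi>))" if "h \<in> closed_span H (\<phi> ` E)" for h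
  proof -
    have "inn H h g = 0" if "g \<in> carr H" "hat E H \<phi> g = 0" for g
    proof (rule orth_closed_span[OF \<phi>_sub _ _ \<open>h \<in> closed_span H (\<phi> ` E)\<close>])
      fix b assume "b \<in> \<phi> ` E"
      then obtain x where "x \<in> E" "b = \<phi> x" by blast
      then show "inn H g b = 0"
        using fun_cong[OF that(2), of x] by (simp add: hat_def fun_on_def)
    qed (use that in simp)
    then show ?thesis
      using closed_span_carr[OF that] by (auto simp: orth_compl_def kernel_on_def)
  qed
  then show "f \<in> orth_compl H (kernel_on H (hat E H \<phi>))" "g \<in> orth_compl H (kernel_on H (hat E H \<phi>))"
    using assms by auto
qed

text \<open>
  A function and its projection onto the closed span have the same inner products with \<open>\<phi>(E)\<close>, hence
  the same transform.
\<close>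

lemma integral_transform_carr:
  "carr (integral_transform E H \<phi>) = hat E H \<phi> ` closed_span H (\<phi> ` E)"
proof -
  have "hat E H \<phi> h \<in> hat E H \<phi> ` closed_span H (\<phi> ` E)" if h: "h \<in> carr H" for h
  proof -
    obtain k where k: "k \<in> closed_span H (\<phi> ` E)"
      and eq: "\<And>f. f \<in> closed_span H (\<phi> ` E) \<Longrightarrow> inn H f h = inn H f k"
      using projection_closed_span[OF \<phi>_sub h] by blast
    have "inn H h (\<phi> x) = inn H k (\<phi> x)" if "x \<in> E" for x
    proof -
      have "\<phi> x \<in> closed_span H (\<phi> ` E)" "\<phi> x \<in> carr H"
        using subset_closed_span[OF \<phi>_sub] \<phi> that by auto
      then show ?thesis
        using eq[of "\<phi> x"] inn_sym[of "\<phi> x" h] inn_sym[of "\<phi> x" k] h closed_span_carr[OF k]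
        by simp
    qed
    then have "hat E H \<phi> h = hat E H \<phi> k"
      by (auto simp: hat_def fun_on_def)
    then show ?thesis using k by blast
  qed
  then show ?thesis
    using closed_span_carr by (auto simp: integral_transform_def operator_range_def)
qed

section \<open>Inversion of the integral transform\<close>

lemma inversion_iff_rkhs:
  "((\<forall>t\<in>T. fun_on E (\<lambda>x. cnj (\<phi> x t)) \<in> carr (integral_transform E H \<phi>)) \<and>
       (\<forall>f\<in>closed_span H (\<phi> ` E). \<forall>t\<in>T.
          f t = inn (integral_transform E H \<phi>) (hat E H \<phi> f) (fun_on E (\<lambda>x. cnj (\<phi> x t)))))
      \<longleftrightarrow> rkhs T (with_carrier H (closed_span H (\<phi> ` E)))" (is "?I \<longleftrightarrow> ?II")
proof -
  let ?M = "closed_span H (\<phi> ` E)" and ?u = "\<lambda>t. fun_on E (\<lambda>x. cnj (\<phi> x t))"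
  interpret M: hilbert_functions "with_carrier H ?M" by (rule closed_span_hilbert[OF \<phi>_sub])
  have carr_M [simp]: "carr (with_carrier H ?M) = ?M"
    and inn_M [simp]: "inn (with_carrier H ?M) = inn H"
    and hnorm_M [simp]: "hnorm (with_carrier H ?M) = hnorm H"
    by (simp_all add: with_carrier_def hnorm_def fun_eq_iff)
  have hilb: "hilbert_function_space T (with_carrier H ?M)"
    using H closed_span_carr M.inner_function_space_axioms M.mcomplete
    unfolding hilbert_function_space_iff by auto
  show ?thesis
  proof
    assume ?I
    have "\<exists>C. \<forall>f\<in>?M. cmod (f t) \<le> C * hnorm H f" if t: "t \<in> T" for t
    proof -
      obtain k where k: "k \<in> ?M" "?u t = hat E H \<phi> k"
        using \<open>?I\<close> t integral_transform_carr by auto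
      have "f t = inn H f k" if "f \<in> ?M" for f
      proof -
        have "f t = inn (integral_transform E H \<phi>) (hat E H \<phi> f) (?u t)"
          using \<open>?I\<close> t that by blast
        then show ?thesis using k that by (simp add: integral_transform_inner)
      qed
      then have "cmod (f t) \<le> hnorm H k * hnorm H f" if "f \<in> ?M" for f
        using Cauchy_Schwarz[of f k] that k closed_span_carr by (simp add: mult.commute)
      then show ?thesis by blast
    qed
    then show ?II using hilb by (simp add: rkhs_def)
  next
    assume ?II
    have "\<exists>k\<in>?M. ?u t = hat E H \<phi> k \<and> (\<forall>f\<in>?M. f t = inn H f k)" if t: "t \<in> T" for t
    proof -
      obtain C where C: "\<And>f. f \<in> ?M \<Longrightarrow> cmod (f t) \<le> C * hnorm H f"
        using \<open>?II\<close> t unfolding rkhs_def carr_M hnorm_M by blast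
      obtain k where k: "k \<in> ?M" and eval: "\<And>f. f \<in> ?M \<Longrightarrow> f t = inn H f k"
        using M.Riesz_representation[of "\<lambda>f. f t" C] C by (auto simp: fun_scale_def)
      have "cnj (\<phi> x t) = inn H k (\<phi> x)" if "x \<in> E" for x
      proof -
        have "\<phi> x \<in> ?M" "\<phi> x \<in> carr H"
          using subset_closed_span[OF \<phi>_sub] \<phi> that by auto
        then show ?thesis
          using eval[of "\<phi> x"] inn_sym[of "\<phi> x" k] closed_span_carr[OF k] by simp
      qed
      then have "?u t = hat E H \<phi> k" by (auto simp: hat_def fun_on_def)
      then show ?thesis using k eval by blast
    qed
    then have "?u t \<in> carr (integral_transform E H \<phi>) \<and>
        (\<forall>f\<in>?M. f t = inn (integral_transform E H \<phi>) (hat E H \<phi> f) (?u t))" if "t \<in> T" for t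
      using that by (fastforce simp: integral_transform_carr integral_transform_inner)
    then show ?I by blast
  qed
qed

end

text \<open>
  When \<open>\<phi>(E)\<close> is complete, the closed span is \<open>H\<close> itself, so the last part is an instance of the
  equivalence.
\<close>

theorem theorem3p1:
  fixes E :: "'e set" and T :: "'t set"
    and H :: "('t \<Rightarrow> complex) inner_space"
    and \<phi> :: "'e \<Rightarrow> 't \<Rightarrow> complex"
  assumes "hilbert_function_space T H"
    and "\<phi> \<in> E \<rightarrow> carr H"
  shows
    "(((\<forall>t\<in>T. fun_on E (\<lambda>x. cnj (\<phi> x t)) \<in> carr (integral_transform E H \<phi>)) \<and>
       (\<forall>f\<in>closed_span H (\<phi> ` E). \<forall>t\<in>T.
          f t = inn (integral_transform E H \<phi>) (hat E H \<phi> f) (fun_on E (\<lambda>x. cnj (\<phi> x t)))))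
      \<longleftrightarrow> rkhs T (with_carrier H (closed_span H (\<phi> ` E))))
     \<and>
     (rkhs T H \<and> complete_in (\<phi> ` E) H \<longrightarrow>
       (\<forall>t\<in>T. fun_on E (\<lambda>x. cnj (\<phi> x t)) \<in> carr (integral_transform E H \<phi>)) \<and>
       (\<forall>f\<in>carr H. \<forall>t\<in>T.
          f t = inn (integral_transform E H \<phi>) (hat E H \<phi> f) (fun_on E (\<lambda>x. cnj (\<phi> x t)))))"
proof (rule conjI[OF inversion_iff_rkhs[OF assms] impI], goal_cases)
  case 1
  then have "closed_span H (\<phi> ` E) = carr H" "with_carrier H (carr H) = H"
    by (simp_all add: complete_in_def with_carrier_def)
  with 1 show ?case
    using inversion_iff_rkhs[OF assms] by simp
qed

end
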